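(* Let $X=[x_1,\dots,x_n]$ be a finite set of vectors in $\mathbb{R}^m$. Suppose $X$ has an MSS $\{X_0,X_1,\dots,X_K\}$ with $K$ minimal sample subspaces $\mathrm{span}(X_1),\dots,\mathrm{span}(X_K)$ that satisfies the non-intersection condition, and suppose that $n(X_k)>(K+1)\,(r(X_k)-1)$ for all $k=1,\dots,K$. Then any different MSS $\{X_0',X_1',\dots,X_{K'}'\}$ of $X$ that satisfies the non-intersection condition, if it exists, has more minimal sample subspaces, i.e. $K'>K$.
   Context: A real matrix $X=[x_1,\dots,x_n]$ is identified with the (indexed) finite set of its columns; a subset $X'$ of $X$ is a column submatrix. $r(X')$ and $n(X')$ denote the rank and the number of columns of $X'$, and $\mathrm{span}(X')$ its column space. A set $X'$ is nondegenerate if every subset of $X'$ with rank smaller than $r(X')$ is of full column rank. A sample subspace $\mathrm{span}(X')$ (together with its spanning set $X'$) is minimal if (1) $n(X')>r(X')$ and (2) $X'$ is nondegenerate. It is pure if $n(X')=r(X')$. A minimal subspace segmentation (MSS) of $X$ is a partition of the columns of $X$ into nonempty segments $X_0,X_1,\dots,X_K$ ($K\ge 0$; $X_0$ may be absent) such that: (1) $\mathrm{span}(X_0)$ is pure if $X_0$ exists, and each $\mathrm{span}(X_k)$, $k=1,\dots,K$, is minimal; (2) $\mathrm{span}(X_k)\ne\mathrm{span}(X_\ell)$ for all $k\neq\ell$; (3) if $X_0$ exists, then for every $x_j\in X_0$, $x_j\notin\mathrm{span}(X_k)$ for $k=1,\dots,K$. Two MSSs are regarded as the same if they consist of the same segments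 up to reordering. A segmentation $\{X_0,\dots,X_K\}$ satisfies the non-intersection condition if $x_j\notin\mathrm{span}(X_k)\cap\mathrm{span}(X_\ell)$ for all $j=1,\dots,n$ and all $k\ne\ell$, where $k,\ell$ range over the indices of all existing segments (including $0$ if $X_0$ exists). *)

theory Defs
  imports "HOL-Analysis.Analysis"
begin

text \<open>
  A column submatrix of \<open>X\<close> is given by the set \<open>S\<close> of its column indices, so that repeated
  columns are counted with multiplicity: its number of columns is \<open>card S\<close>, not the cardinality
  of the set of vectors \<open>cols X S\<close>.
\<close>

definition cols :: "real^'n^'m \<Rightarrow> 'n set \<Rightarrow> (real^'m) set"
  where "cols X S = (\<lambda>j. column j X) ` S"

definition sub_rank :: "real^'n^'m \<Rightarrow> 'n set \<Rightarrow> nat"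
  where "sub_rank X S = dim (cols X S)"

definition full_column_rank :: "real^'n^'m \<Rightarrow> 'n set \<Rightarrow> bool"
  where "full_column_rank X S \<longleftrightarrow> sub_rank X S = card S"

definition nondegenerate :: "real^'n^'m \<Rightarrow> 'n set \<Rightarrow> bool"
  where "nondegenerate X S \<longleftrightarrow>
    (\<forall>T. T \<subseteq> S \<and> sub_rank X T < sub_rank X S \<longrightarrow> full_column_rank X T)"

definition minimal_sample :: "real^'n^'m \<Rightarrow> 'n set \<Rightarrow> bool"
  where "minimal_sample X S \<longleftrightarrow> card S > sub_rank X S \<and> nondegenerate X S"

definition pure_sample :: "real^'n^'m \<Rightarrow> 'n set \<Rightarrow> bool"
  where "pure_sample X S \<longleftrightarrow> card S = sub_rank X S"

text \<open>
  A segmentation is given by \<open>K\<close> and a family \<open>P\<close>, of which only \<open>P 0, \<dots>, P K\<close> matter;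
  \<open>P 0 = {}\<close> encodes that the pure segment is absent. An absent segment must not take part in
  the comparison of spans, since \<open>span {} = {0}\<close> is also the span of a segment of zero columns.
\<close>

definition seg_indices :: "nat \<Rightarrow> (nat \<Rightarrow> 'n set) \<Rightarrow> nat set"
  where "seg_indices K P = {k. k \<le> K \<and> P k \<noteq> {}}"

definition segments :: "nat \<Rightarrow> (nat \<Rightarrow> 'n set) \<Rightarrow> 'n set set"
  where "segments K P = P ` seg_indices K P"

definition is_MSS :: "real^'n^'m \<Rightarrow> nat \<Rightarrow> (nat \<Rightarrow> 'n set) \<Rightarrow> bool"
  where "is_MSS X K P \<longleftrightarrow>
    disjoint_family_on P {0..K} \<and> (\<Union>k\<in>{0..K}. P k) = UNIV \<and> (\<forall>k\<in>{1..K}. P k \<noteq> {}) \<and>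
    (P 0 \<noteq> {} \<longrightarrow> pure_sample X (P 0)) \<and>
    (\<forall>k\<in>{1..K}. minimal_sample X (P k)) \<and>
    (\<forall>k\<in>seg_indices K P. \<forall>l\<in>seg_indices K P. k \<noteq> l \<longrightarrow>
       span (cols X (P k)) \<noteq> span (cols X (P l))) \<and>
    (\<forall>j\<in>P 0. \<forall>k\<in>{1..K}. column j X \<notin> span (cols X (P k)))"

definition non_intersecting :: "real^'n^'m \<Rightarrow> nat \<Rightarrow> (nat \<Rightarrow> 'n set) \<Rightarrow> bool"
  where "non_intersecting X K P \<longleftrightarrow>
    (\<forall>j. \<forall>k\<in>seg_indices K P. \<forall>l\<in>seg_indices K P. k \<noteq> l \<longrightarrow>
       column j X \<notin> span (cols X (P k)) \<inter> span (cols X (P l)))"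

end

theory Submission
  imports Defs
begin

text \<open>
  Suppose \<open>K' \<le> K\<close>. The at most \<open>K + 1\<close> segments of \<open>P'\<close> cover \<open>P k\<close>, so by the pigeonhole
  principle some \<open>P' l\<close> contains at least \<open>sub_rank X (P k)\<close> columns of \<open>P k\<close>. These span
  \<open>span (P k)\<close> by nondegeneracy, hence \<open>span (P k) \<subseteq> span (P' l)\<close>, and non-intersection
  upgrades this to \<open>P k \<subseteq> P' l\<close>. Since \<open>P k\<close> has dependent columns, \<open>P' l\<close> is not pure, and
  its nondegeneracy forces both spans to agree; non-intersection for \<open>P\<close> then gives
  \<open>P k = P' l\<close>. Thus every minimal segment of \<open>P\<close> is one of \<open>P'\<close>; counting yields \<open>K = K'\<close>,
  and the pure segments agree as complements.
\<close>

text \<open>The rank is at most the number of distinct columns, which is at most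
  \<open>card S\<close>; full rank forces equality in both. In this form the property visibly passes
  to subsets.\<close>

lemma full_column_rank_iff:
  "full_column_rank X S \<longleftrightarrow> inj_on (\<lambda>j. column j X) S \<and> independent (cols X S)"
proof
  assume "full_column_rank X S"
  then have r: "dim (cols X S) = card S"
    by (simp add: full_column_rank_def sub_rank_def)
  have fin: "finite (cols X S)"
    by (simp add: cols_def)
  have "dim (cols X S) \<le> card (cols X S)" "card (cols X S) \<le> card S"
    using dim_le_card'[OF fin] by (auto simp: cols_def card_image_le)
  with r have c: "card (cols X S) = card S" by simp
  then have "inj_on (\<lambda>j. column j X) S"
    by (intro eq_card_imp_inj_on) (auto simp: cols_def)
  moreover have "independent (cols X S)"
    using card_eq_dim[OF subset_refl _ fin] c r span_superset by auto
  ultimately show "inj_on (\<lambda>j. column j X) S \<and> independent (cols X S)" ..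
next
  assume "inj_on (\<lambda>j. column j X) S \<and> independent (cols X S)"
  then show "full_column_rank X S"
    by (simp add: full_column_rank_def sub_rank_def dim_eq_card_independent)
      (simp add: cols_def card_image)
qed

lemma full_column_rank_subset:
  "full_column_rank X T \<Longrightarrow> S \<subseteq> T \<Longrightarrow> full_column_rank X S"
  unfolding full_column_rank_iff cols_def
  by (elim conjE, intro conjI, erule (1) inj_on_subset, erule independent_mono, erule image_mono)

lemma span_cols_eqI:
  "S \<subseteq> T \<Longrightarrow> sub_rank X T \<le> sub_rank X S \<Longrightarrow> span (cols X S) = span (cols X T)"
  unfolding sub_rank_def cols_def by (intro dim_eq_span image_mono)

text \<open>If the rank of \<open>T\<close> were smaller, nondegeneracy would make it equal to
  \<open>card T\<close>, which is already at least the rank of \<open>S\<close>.\<close>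

lemma nondegenerate_span_eq:
  assumes "nondegenerate X S" "T \<subseteq> S" "sub_rank X S \<le> card T"
  shows "span (cols X T) = span (cols X S)"
proof (rule span_cols_eqI[OF \<open>T \<subseteq> S\<close>], rule ccontr)
  assume "\<not> sub_rank X S \<le> sub_rank X T"
  moreover from this have "sub_rank X T = card T"
    using assms by (auto simp: nondegenerate_def full_column_rank_def)
  ultimately show False
    using assms(3) by simp
qed

lemma column_in_span_cols: "j \<in> S \<Longrightarrow> column j X \<in> span (cols X S)"
  unfolding cols_def by (intro span_base imageI)

lemma span_cols_mono: "S \<subseteq> T \<Longrightarrow> span (cols X S) \<subseteq> span (cols X T)"
  unfolding cols_def by (intro span_mono image_mono)

text \<open>Every column lies in the span of its own segment; were that segment not
  \<open>P l\<close>, the column would lie in two of the spans.\<close>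

lemma subset_segment_if_span_subset:
  assumes "is_MSS X K P" "non_intersecting X K P" "l \<in> seg_indices K P"
    and "span (cols X S) \<subseteq> span (cols X (P l))"
  shows "S \<subseteq> P l"
proof
  fix j assume "j \<in> S"
  then have jl: "column j X \<in> span (cols X (P l))"
    using assms(4) column_in_span_cols by blast
  have "j \<in> (\<Union>k\<in>{0..K}. P k)"
    using assms(1) by (simp add: is_MSS_def)
  then obtain i where i: "i \<le> K" "j \<in> P i"
    by auto
  then have "i \<in> seg_indices K P"
    by (auto simp: seg_indices_def)
  with jl i(2) assms(2,3) column_in_span_cols[of j "P i" X] have "i = l"
    unfolding non_intersecting_def by blast
  with i(2) show "j \<in> P l" by simp
qed

lemma ex_large_segment_part:
  assumes "is_MSS X K P" "card S > (K + 1) * m"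
  shows "\<exists>l\<le>K. card (S \<inter> P l) > m"
proof (rule ccontr)
  assume "\<not> ?thesis"
  then have small: "card (S \<inter> P l) \<le> m" if "l \<le> K" for l
    using that by (simp add: not_less)
  have "(\<Union>l\<in>{0..K}. P l) = UNIV"
    using assms(1) by (simp add: is_MSS_def)
  then have "S = (\<Union>l\<in>{0..K}. S \<inter> P l)" by blast
  then have "card S = card (\<Union>l\<in>{0..K}. S \<inter> P l)"
    by (rule arg_cong)
  also have "\<dots> \<le> (\<Sum>l\<in>{0..K}. card (S \<inter> P l))"
    by (rule card_UN_le) simp
  also have "\<dots> \<le> (\<Sum>l\<in>{0..K}. m)"
    by (intro sum_mono small) simp
  finally show False
    using assms(2) by simp
qed

text \<open>The truncated subtraction is harmless: for rank 0 it only asks for a nonempty segment.\<close>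

lemma minimal_segment_recovered:
  assumes P: "is_MSS X K P" "non_intersecting X K P"
    and P': "is_MSS X K' P'" "non_intersecting X K' P'"
    and k: "k \<in> {1..K}"
    and large: "card (P k) > (K' + 1) * (sub_rank X (P k) - 1)"
  shows "\<exists>l\<in>{1..K'}. P' l = P k"
proof -
  have "minimal_sample X (P k)"
    using P(1) k by (simp add: is_MSS_def)
  then have dep: "card (P k) > sub_rank X (P k)" and nd: "nondegenerate X (P k)"
    by (simp_all add: minimal_sample_def)
  have kseg: "k \<in> seg_indices K P"
    using P(1) k by (auto simp: is_MSS_def seg_indices_def)
  obtain l where l: "l \<le> K'" and "card (P k \<inter> P' l) > sub_rank X (P k) - 1"
    using ex_large_segment_part[OF P'(1) large] by blast
  then have rank: "sub_rank X (P k) \<le> card (P k \<inter> P' l)" and "P k \<inter> P' l \<noteq> {}"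
    by auto
  then have lseg: "l \<in> seg_indices K' P'"
    using l by (auto simp: seg_indices_def)
  have "span (cols X (P k)) = span (cols X (P k \<inter> P' l))"
    using nondegenerate_span_eq[OF nd _ rank] by simp
  also have "\<dots> \<subseteq> span (cols X (P' l))"
    by (intro span_cols_mono) simp
  finally have sub: "P k \<subseteq> P' l"
    by (rule subset_segment_if_span_subset[OF P' lseg])
  have not_full: "\<not> full_column_rank X (P k)"
    using dep by (simp add: full_column_rank_def)
  have "l \<noteq> 0"
  proof
    assume "l = 0"
    then have "full_column_rank X (P' l)"
      using P'(1) lseg by (simp add: is_MSS_def seg_indices_def pure_sample_def full_column_rank_def)
    with not_full sub show False
      using full_column_rank_subset by blast
  qed
  with l have l1: "l \<in> {1..K'}" by simp
  then have "nondegenerate X (P' l)"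
    using P'(1) by (simp add: is_MSS_def minimal_sample_def)
  \<comment> \<open>Contrapositive of nondegeneracy: a subset without full column rank cannot have
    smaller rank.\<close>
  then have "sub_rank X (P' l) \<le> sub_rank X (P k)"
    using not_full sub unfolding nondegenerate_def by (meson not_less)
  then have "span (cols X (P k)) = span (cols X (P' l))"
    by (rule span_cols_eqI[OF sub])
  then have "P' l \<subseteq> P k"
    using subset_segment_if_span_subset[OF P kseg] by simp
  with sub l1 show ?thesis by blast
qed

lemma MSS_inj_on:
  assumes "is_MSS X K P"
  shows "inj_on P {1..K}"
proof (rule inj_onI)
  fix a b assume ab: "a \<in> {1..K}" "b \<in> {1..K}" "P a = P b"
  show "a = b"
  proof (rule ccontr)
    assume "a \<noteq> b"
    then have "P a \<inter> P b = {}"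
      using assms ab disjoint_family_onD[of P "{0..K}" a b] by (auto simp: is_MSS_def)
    with ab assms show False
      by (auto simp: is_MSS_def)
  qed
qed

lemma MSS_pure_segment:
  assumes "is_MSS X K P"
  shows "P 0 = UNIV - \<Union>(P ` {1..K})"
proof -
  have "P 0 \<inter> P k = {}" if "k \<in> {1..K}" for k
    using assms that disjoint_family_onD[of P "{0..K}" 0 k] by (auto simp: is_MSS_def)
  moreover have "{0..K} = insert 0 {1..K}" by auto
  then have "P 0 \<union> \<Union>(P ` {1..K}) = UNIV"
    using assms by (simp add: is_MSS_def)
  ultimately show ?thesis by blast
qed

text \<open>The minimal segments alone determine the segmentation; removing \<open>{}\<close>
  accounts for an absent pure segment.\<close>

lemma MSS_segments:
  assumes "is_MSS X K P"
  shows "segments K P = (P ` {1..K} \<union> {UNIV - \<Union>(P ` {1..K})}) - {{}}"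
proof -
  have "{..K} = insert 0 {1..K}" by auto
  then have "P ` {..K} = P ` {1..K} \<union> {P 0}" by simp
  moreover have "segments K P = P ` {..K} - {{}}"
    by (auto simp: segments_def seg_indices_def)
  ultimately show ?thesis
    by (simp only: MSS_pure_segment[OF assms])
qed

theorem theorem2:
  fixes X :: "real^'n^'m"
    and P P' :: "nat \<Rightarrow> 'n set"
    and K K' :: nat
  assumes "is_MSS X K P"
    and "non_intersecting X K P"
    and "\<And>k. k \<in> {1..K} \<Longrightarrow>
      int (card (P k)) > (int K + 1) * (int (sub_rank X (P k)) - 1)"
    and "is_MSS X K' P'"
    and "non_intersecting X K' P'"
    and "segments K' P' \<noteq> segments K P"
  shows "K' > K"
proof (rule ccontr)
  assume "\<not> K' > K"
  then have le: "K' \<le> K" by simp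
  have "P k \<in> P' ` {1..K'}" if k: "k \<in> {1..K}" for k
  proof -
    \<comment> \<open>For rank 0 the integer bound is negative, while the truncated one demands a
      nonempty segment.\<close>
    have pos: "card (P k) > 0"
      using assms(1) k by (simp add: is_MSS_def card_gt_0_iff)
    have "card (P k) > (K + 1) * (sub_rank X (P k) - 1)"
    proof (cases "sub_rank X (P k)")
      case (Suc r)
      then have "int (card (P k)) > int ((K + 1) * r)"
        using assms(3)[OF k] by (simp add: algebra_simps)
      with Suc show ?thesis by (simp only: of_nat_less_iff diff_Suc_1)
    qed (use pos in simp)
    moreover have "(K' + 1) * (sub_rank X (P k) - 1) \<le> (K + 1) * (sub_rank X (P k) - 1)"
      using le by (intro mult_right_mono) auto
    ultimately have "\<exists>l\<in>{1..K'}. P' l = P k"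
      by (intro minimal_segment_recovered[OF assms(1,2,4,5) k]) linarith
    then show ?thesis by force
  qed
  then have sub: "P ` {1..K} \<subseteq> P' ` {1..K'}" by blast
  \<comment> \<open>Injectivity of \<open>P\<close> makes the right-hand side \<open>K\<close>, so
    the inclusion \<open>sub\<close> must be an equality.\<close>
  have "card (P' ` {1..K'}) \<le> card (P ` {1..K})"
    using card_image_le[of "{1..K'}" P'] card_image[OF MSS_inj_on[OF assms(1)]] le by simp
  then have "P ` {1..K} = P' ` {1..K'}"
    using sub by (intro card_seteq) auto
  then show False
    using assms(6) MSS_segments[OF assms(1)] MSS_segments[OF assms(4)] by simp
qed

end
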